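(* For any integers $k\ge0$, $\ell\ge1$, and $b\ge2$, $$S(1^k b^\ell;t,x)=\frac{t^{k+\ell}x^{k+b\ell}}{(1-x)^{k+1}\Big((tx^b)^{\ell-1}\big(1-tx[b-1]_x\big)+(1-x-tx)\sum_{i=0}^{\ell-2}(1-x)^i(tx^b)^{\ell-2-i}\Big)}.$$
   Context: $\mathbb{P}$ is the positive integers; $\mathbb{P}^*$ the finite words over $\mathbb{P}$. Generalized factor order: $u\le w$ iff there is a factor $w'$ of $w$ (consecutive letters) with $|w'|=|u|$ and $u_i\le w'_i$ for all $i$; such $w'$ is an embedding. $\mathcal{S}(u)$ is the set of $w\ge u$ such that every embedding of $u$ into $w$ is a suffix of $w$. The weight of $w=w_1\cdots w_\ell$ is $t^\ell x^{w_1+\cdots+w_\ell}$, and $S(u;t,x)=\sum_{w\in\mathcal{S}(u)}\mathrm{wt}(w)$. $1^kb^\ell$ is the word of $k$ ones followed by $\ell$ copies of $b$. $[m]_x=1+x+\cdots+x^{m-1}$. *)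

theory Defs
  imports "HOL-Computational_Algebra.Formal_Power_Series"
begin

unbundle fps_syntax

definition words :: "nat list set" where
  "words = lists {a. 0 < a}"

text \<open>
  An embedding is an occurrence of a factor, so it is recorded together with the
  prefix \<open>p\<close> and the suffix \<open>s\<close> surrounding it: equal factors at different positions
  are different embeddings.
\<close>
definition embedding :: "nat list \<Rightarrow> nat list \<Rightarrow> nat list \<Rightarrow> nat list \<Rightarrow> nat list \<Rightarrow> bool" where
  "embedding u w p w' s \<longleftrightarrow>
     w = p @ w' @ s \<and> length w' = length u \<and> (\<forall>i<length u. u ! i \<le> w' ! i)"

definition factor_le :: "nat list \<Rightarrow> nat list \<Rightarrow> bool" where
  "factor_le u w \<longleftrightarrow> (\<exists>p w' s. embedding u w p w' s)"

definition suffix_words :: "nat list \<Rightarrow> nat list set" where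
  "suffix_words u =
     {w \<in> words. factor_le u w \<and> (\<forall>p w' s. embedding u w p w' s \<longrightarrow> s = [])}"

text \<open>
  Formal power series in \<open>t\<close> and \<open>x\<close> are series in \<open>t\<close> whose coefficients are series in \<open>x\<close>.
\<close>
abbreviation t_var :: "rat fps fps" where
  "t_var \<equiv> fps_X"

abbreviation x_var :: "rat fps fps" where
  "x_var \<equiv> fps_const fps_X"

definition wt :: "nat list \<Rightarrow> rat fps fps" where
  "wt w = t_var ^ length w * x_var ^ sum_list w"

text \<open>
  The sum of a family of bivariate series, taken coefficientwise.  It is meaningful when every
  coefficient is nonzero for only finitely many members of the family.  The infinite sums
  of the library do not apply: for the metric on series in \<open>t\<close>, the coefficients carry
  the discrete topology, and infinitely many words have the same length.
\<close>
definition formal_sum :: "('a \<Rightarrow> rat fps fps) \<Rightarrow> 'a set \<Rightarrow> rat fps fps" where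
  "formal_sum f A =
     Abs_fps (\<lambda>n. Abs_fps (\<lambda>m. \<Sum>a\<in>{a \<in> A. f a $ n $ m \<noteq> 0}. f a $ n $ m))"

definition S_gf :: "nat list \<Rightarrow> rat fps fps" where
  "S_gf u = formal_sum wt (suffix_words u)"

definition q_int :: "nat \<Rightarrow> 'a::comm_semiring_1 \<Rightarrow> 'a" where
  "q_int m q = (\<Sum>i<m. q ^ i)"

lemma wt_nth: "wt w $ n $ m = (if length w = n \<and> sum_list w = m then 1 else 0)"
  by (simp add: wt_def fps_const_power fps_mult_right_const_nth fps_X_power_nth)

lemma finite_words_length_sum: "finite {w \<in> words. length w = n \<and> sum_list w = m}"
proof (rule finite_subset)
  show "{w \<in> words. length w = n \<and> sum_list w = m} \<subseteq> {w. set w \<subseteq> {..m} \<and> length w = n}"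
    using member_le_sum_list by fastforce
qed (simp add: finite_lists_length_eq)

text \<open>So the sum defining \<open>S_gf\<close> is meaningful, and it counts words by length and letter sum.\<close>

lemma finite_wt_support: "finite {w \<in> suffix_words u. wt w $ n $ m \<noteq> 0}"
  and S_gf_nth:
    "S_gf u $ n $ m = of_nat (card {w \<in> suffix_words u. length w = n \<and> sum_list w = m})"
proof -
  have eq: "{w \<in> suffix_words u. wt w $ n $ m \<noteq> 0}
      = {w \<in> suffix_words u. length w = n \<and> sum_list w = m}"
    by (auto simp: wt_nth split: if_splits)
  show "finite {w \<in> suffix_words u. wt w $ n $ m \<noteq> 0}"
    unfolding eq by (rule finite_subset[OF _ finite_words_length_sum[of n m]])
      (auto simp: suffix_words_def)
  have "S_gf u $ n $ m = (\<Sum>w\<in>{w \<in> suffix_words u. length w = n \<and> sum_list w = m}. wt w $ n $ m)"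
    by (simp add: S_gf_def formal_sum_def eq)
  also have "\<dots> = (\<Sum>w\<in>{w \<in> suffix_words u. length w = n \<and> sum_list w = m}. 1)"
    by (rule sum.cong) (auto simp: wt_nth)
  finally show "S_gf u $ n $ m
      = of_nat (card {w \<in> suffix_words u. length w = n \<and> sum_list w = m})"
    by simp
qed

text \<open>
  Division of series with coefficients in a ring that is not a field is a genuine quotient as
  soon as the constant term of the denominator is invertible; this is so for the
  denominators of the main statement.
\<close>

lemma fps_fps_divide_mult_cancel:
  fixes f g :: "rat fps fps"
  assumes "g $ 0 $ 0 \<noteq> 0"
  shows "f / g * g = f"
proof -
  have "g $ 0 \<noteq> 0" using assms by auto
  hence s: "subdegree g = 0" by simp
  have u: "unit_factor g = g" using s by simp
  have "g $ 0 * inverse (g $ 0) = 1" using assms by (rule inverse_mult_eq_1')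
  hence "g * inverse g = 1" unfolding fps_inverse_def by (rule fps_right_inverse)
  thus ?thesis unfolding fps_divide_def s u by (simp add: mult.assoc mult.commute[of _ g])
qed

lemma denominator_nth_0_0:
  fixes k l b :: nat
  assumes "l \<ge> 1" "b \<ge> 2"
  shows "((1 - x_var) ^ (k + 1) *
       ((t_var * x_var ^ b) ^ (l - 1) * (1 - t_var * x_var * q_int (b - 1) x_var)
         + (1 - x_var - t_var * x_var) *
           (\<Sum>i<l - 1. (1 - x_var) ^ i * (t_var * x_var ^ b) ^ (l - 2 - i)))) $ 0 $ 0 = 1"
proof (cases "l = 1")
  case True
  thus ?thesis by (simp add: fps_power_zeroth)
next
  case False
  then obtain j where j: "l = Suc (Suc j)"
    using assms(1) by (metis One_nat_def Suc_le_D le_zero_eq not0_implies_Suc)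
  show ?thesis
    unfolding j by (simp add: fps_sum_nth fps_power_zeroth sum.neutral)
qed

end

theory Submission
  imports Defs "HOL-Library.Disjoint_Sets"
begin

text \<open>
  Let \<open>P\<close>, \<open>A\<close>, \<open>B\<close> be the generating functions of all letters, of the letters \<open>\<ge> b\<close> and of
  the letters \<open>< b\<close>.  Dropping the first \<open>k\<close> letters shows \<open>S(1\<^sup>k u) = P\<^sup>k S(u)\<close>.
  A word of \<open>\<S>(b\<^sup>l)\<close> either consists of \<open>l\<close> letters \<open>\<ge> b\<close>, or its first letter \<open>< b\<close> has
  \<open>i < l\<close> letters before it and a word of \<open>\<S>(b\<^sup>l)\<close> after it.  Hence
  \<open>S(b\<^sup>l) = A\<^sup>l + (\<Sum>i<l. A\<^sup>i B) S(b\<^sup>l)\<close>, and the claim follows from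
  \<open>(1 - x) A = t x\<^sup>b\<close> and \<open>(1 - x) B = t x - t x\<^sup>b\<close>.
\<close>

section \<open>Generating functions of sets of words\<close>

text \<open>Reduces identities between generating functions of sets of words to identities between
  cardinalities, one coefficient at a time.\<close>

lemma formal_sum_wt_nth:
  "formal_sum wt A $ n $ m = of_nat (card {w \<in> A. length w = n \<and> sum_list w = m})"
proof -
  have eq: "{w \<in> A. wt w $ n $ m \<noteq> 0} = {w \<in> A. length w = n \<and> sum_list w = m}"
    by (auto simp: wt_nth split: if_splits)
  have "formal_sum wt A $ n $ m
      = (\<Sum>w\<in>{w \<in> A. length w = n \<and> sum_list w = m}. wt w $ n $ m)"
    by (simp add: formal_sum_def eq)
  also have "\<dots> = (\<Sum>w\<in>{w \<in> A. length w = n \<and> sum_list w = m}. 1)"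
    by (rule sum.cong) (auto simp: wt_nth)
  finally show ?thesis by simp
qed

lemma finite_words_subset:
  assumes "A \<subseteq> words"
  shows "finite {w \<in> A. length w = n \<and> sum_list w = m}"
  by (rule finite_subset[OF _ finite_words_length_sum[of n m]]) (use assms in auto)

text \<open>Cardinality is additive over finite disjoint unions; inclusion in \<open>words\<close>
  supplies the finiteness of the counted sets.\<close>

lemma formal_sum_wt_UN:
  assumes "finite I" and "\<And>i. i \<in> I \<Longrightarrow> A i \<subseteq> words" and "disjoint_family_on A I"
  shows "formal_sum wt (\<Union>i\<in>I. A i) = (\<Sum>i\<in>I. formal_sum wt (A i))"
proof (intro fps_ext)
  fix n m
  have "{w \<in> (\<Union>i\<in>I. A i). length w = n \<and> sum_list w = m}
      = (\<Union>i\<in>I. {w \<in> A i. length w = n \<and> sum_list w = m})"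
    by auto
  moreover have "card \<dots> = (\<Sum>i\<in>I. card {w \<in> A i. length w = n \<and> sum_list w = m})"
    using assms by (intro card_UN_disjoint) (fastforce intro: finite_words_subset
        simp: disjoint_family_on_def simp del: mem_Collect_eq | blast dest: disjoint_family_onD)+
  ultimately show "formal_sum wt (\<Union>i\<in>I. A i) $ n $ m
      = (\<Sum>i\<in>I. formal_sum wt (A i)) $ n $ m"
    by (simp add: formal_sum_wt_nth fps_sum_nth)
qed

lemma formal_sum_wt_Un:
  assumes "A \<subseteq> words" "B \<subseteq> words" "A \<inter> B = {}"
  shows "formal_sum wt (A \<union> B) = formal_sum wt A + formal_sum wt B"
proof (intro fps_ext)
  fix n m
  have "{w \<in> A \<union> B. length w = n \<and> sum_list w = m}
      = {w \<in> A. length w = n \<and> sum_list w = m} \<union> {w \<in> B. length w = n \<and> sum_list w = m}"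
    by auto
  moreover have "card \<dots> = card {w \<in> A. length w = n \<and> sum_list w = m}
      + card {w \<in> B. length w = n \<and> sum_list w = m}"
    using assms by (intro card_Un_disjoint finite_words_subset) auto
  ultimately show "formal_sum wt (A \<union> B) $ n $ m
      = (formal_sum wt A + formal_sum wt B) $ n $ m"
    by (simp add: formal_sum_wt_nth)
qed

section \<open>Concatenation of sets of words\<close>

definition concat_sets :: "'a list set \<Rightarrow> 'a list set \<Rightarrow> 'a list set" where
  "concat_sets A B = (\<lambda>(u, v). u @ v) ` (A \<times> B)"

lemma concat_setsI: "u \<in> A \<Longrightarrow> v \<in> B \<Longrightarrow> u @ v \<in> concat_sets A B"
  by (auto simp: concat_sets_def)

lemma concat_setsE:
  assumes "w \<in> concat_sets A B"
  obtains u v where "w = u @ v" "u \<in> A" "v \<in> B"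
  using assms by (auto simp: concat_sets_def)

lemma concat_sets_words: "A \<subseteq> words \<Longrightarrow> B \<subseteq> words \<Longrightarrow> concat_sets A B \<subseteq> words"
  by (fastforce simp: concat_sets_def words_def)

text \<open>Since all words of \<open>A\<close> have the same length, the concatenation is unambiguous.\<close>

lemma formal_sum_wt_concat_sets:
  assumes "A \<subseteq> words" "B \<subseteq> words" and len: "\<And>u. u \<in> A \<Longrightarrow> length u = a"
  shows "formal_sum wt (concat_sets A B) = formal_sum wt A * formal_sum wt B"
proof (intro fps_ext)
  fix n m
  let ?C = "\<lambda>X n m. {w \<in> X. length w = n \<and> sum_list w = m}"
  \<comment> \<open>Pairs of words graded by the length \<open>i\<close> and the letter sum
    \<open>j\<close> of the first one, matching the double Cauchy product.\<close>
  let ?U = "\<Union>i\<in>{0..n}. \<Union>j\<in>{0..m}. ?C A i j \<times> ?C B (n - i) (m - j)"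
  have fin: "finite (?C A i j)" "finite (?C B i j)" for i j
    using assms by (simp_all add: finite_words_subset)
  have "?C (concat_sets A B) n m = (\<lambda>(u, v). u @ v) ` ?U"
    by (fastforce simp: concat_sets_def)
  moreover have "inj_on (\<lambda>(u, v). u @ v) ?U"
    using len by (auto simp: inj_on_def)
  ultimately have "card (?C (concat_sets A B) n m) = card ?U"
    by (simp add: card_image)
  also have "\<dots> = (\<Sum>i=0..n. card (\<Union>j\<in>{0..m}. ?C A i j \<times> ?C B (n - i) (m - j)))"
    by (intro card_UN_disjoint) (auto intro!: finite_cartesian_product fin)
  also have "\<dots> = (\<Sum>i=0..n. \<Sum>j=0..m. card (?C A i j \<times> ?C B (n - i) (m - j)))"
    by (intro sum.cong refl card_UN_disjoint) (auto intro!: finite_cartesian_product fin)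
  finally show "formal_sum wt (concat_sets A B) $ n $ m
      = (formal_sum wt A * formal_sum wt B) $ n $ m"
    by (simp add: formal_sum_wt_nth fps_mult_nth fps_sum_nth card_cartesian_product)
qed

section \<open>Words over a given set of letters\<close>

definition words_over :: "nat set \<Rightarrow> nat \<Rightarrow> nat list set" where
  "words_over X n = {w. set w \<subseteq> X \<and> length w = n}"

lemma words_over_words: "0 \<notin> X \<Longrightarrow> words_over X n \<subseteq> words"
  by (force simp: words_over_def words_def intro!: Nat.gr0I)

lemma length_words_over: "w \<in> words_over X n \<Longrightarrow> length w = n"
  by (simp add: words_over_def)

lemma words_over_0: "words_over X 0 = {[]}"
  by (auto simp: words_over_def)

lemma words_over_Suc: "words_over X (Suc n) = concat_sets (words_over X 1) (words_over X n)"
proof (intro equalityI subsetI)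
  fix w assume "w \<in> words_over X (Suc n)"
  then obtain a v where w: "w = [a] @ v" and "[a] \<in> words_over X 1" "v \<in> words_over X n"
    by (auto simp: words_over_def length_Suc_conv)
  thus "w \<in> concat_sets (words_over X 1) (words_over X n)"
    unfolding w by (intro concat_setsI)
qed (auto simp: words_over_def elim!: concat_setsE)

definition letter_gf :: "nat set \<Rightarrow> rat fps fps" where
  "letter_gf X = t_var * fps_const (Abs_fps (\<lambda>m. if m \<in> X then 1 else 0))"

lemma formal_sum_wt_words_over_1: "formal_sum wt (words_over X 1) = letter_gf X"
proof (intro fps_ext)
  fix n m
  have "{w \<in> words_over X 1. length w = n \<and> sum_list w = m}
      = (if n = 1 \<and> m \<in> X then {[m]} else {})"
    by (auto simp: words_over_def length_Suc_conv)
  thus "formal_sum wt (words_over X 1) $ n $ m = letter_gf X $ n $ m"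
    by (auto simp: formal_sum_wt_nth letter_gf_def)
qed

lemma formal_sum_wt_words_over:
  assumes "0 \<notin> X"
  shows "formal_sum wt (words_over X n) = letter_gf X ^ n"
proof (induction n)
  case 0
  have eq: "{w \<in> {[] :: nat list}. length w = n \<and> sum_list w = m}
      = (if n = 0 \<and> m = 0 then {[]} else {})" for n m
    by auto
  have "formal_sum wt {[]} = 1"
    by (intro fps_ext, unfold formal_sum_wt_nth eq) simp
  thus ?case by (simp add: words_over_0)
next
  case (Suc n)
  thus ?case
    unfolding words_over_Suc
    by (subst formal_sum_wt_concat_sets[where a = 1])
      (use assms formal_sum_wt_words_over_1 in \<open>simp_all add: words_over_words length_words_over\<close>)
qed

text \<open>A geometric series in \<open>x\<close>, summed in product form so that no division
  appears. The identity is checked among series in \<open>x\<close> and then lifted through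
  \<open>fps_const\<close>.\<close>

lemma letter_gf_atLeast: "letter_gf {b..} * (1 - x_var) = t_var * x_var ^ b"
proof -
  have "Abs_fps (\<lambda>m. if m \<in> {b..} then 1 else 0) * (1 - fps_X) = (fps_X ^ b :: rat fps)"
    by (intro fps_ext) (auto simp: algebra_simps fps_X_power_nth)
  hence "fps_const (Abs_fps (\<lambda>m. if m \<in> {b..} then 1 else 0)) * (1 - x_var) = x_var ^ b"
    by (metis fps_const_1_eq_1 fps_const_mult fps_const_power fps_const_sub)
  thus ?thesis by (simp add: letter_gf_def mult.assoc)
qed

lemma letter_gf_less:
  assumes "b \<ge> 1"
  shows "letter_gf {1..<b} = t_var * x_var * q_int (b - 1) x_var"
proof -
  \<comment> \<open>The finite set of letters is the difference of two half-lines, so two geometric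
    series suffice.\<close>
  have "letter_gf {1..} = letter_gf {1..<b} + letter_gf {b..}"
    using assms
    by (intro fps_ext) (auto simp: letter_gf_def)
  hence "letter_gf {1..<b} * (1 - x_var) = t_var * x_var - t_var * x_var ^ b"
    using letter_gf_atLeast[of 1] letter_gf_atLeast[of b]
    by (metis add_diff_cancel_right' left_diff_distrib power_one_right)
  also have "\<dots> = t_var * x_var * (1 - x_var ^ (b - 1))"
    using assms by (cases b) (simp_all add: algebra_simps)
  also have "1 - x_var ^ (b - 1) = (1 - x_var) * q_int (b - 1) x_var"
    unfolding q_int_def by (rule one_diff_power_eq)
  finally have "letter_gf {1..<b} * (1 - x_var)
      = (t_var * x_var * q_int (b - 1) x_var) * (1 - x_var)"
    by (simp add: algebra_simps)
  \<comment> \<open>A nonzero factor may be cancelled, as the bivariate series form an integral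
    domain.\<close>
  moreover have "(1 - x_var) $ 0 $ 0 \<noteq> 0" by simp
  hence "1 - x_var \<noteq> 0" by (metis fps_zero_nth)
  ultimately show ?thesis by simp
qed

section \<open>Embeddings by position\<close>

text \<open>Since \<open>u\<close> and \<open>w\<close> are given, the length of the prefix
  determines an embedding; positions therefore replace triples of words from here on.\<close>

definition occurs_at :: "nat list \<Rightarrow> nat list \<Rightarrow> nat \<Rightarrow> bool" where
  "occurs_at u w p \<longleftrightarrow> p + length u \<le> length w \<and> (\<forall>i<length u. u ! i \<le> w ! (p + i))"

lemma embedding_occurs_at:
  assumes "embedding u w p w' s"
  shows "occurs_at u w (length p)" "length w = length p + length u + length s"
  using assms by (auto simp: embedding_def occurs_at_def nth_append)

lemma occurs_at_embedding:
  assumes "occurs_at u w p"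
  shows "embedding u w (take p w) (take (length u) (drop p w)) (drop (p + length u) w)"
proof -
  have "drop (p + length u) w = drop (length u) (drop p w)" by (simp add: add.commute)
  hence "w = take p w @ take (length u) (drop p w) @ drop (p + length u) w"
    by (metis append_take_drop_id)
  thus ?thesis using assms unfolding embedding_def occurs_at_def by auto
qed

text \<open>The suffix of an embedding at position \<open>p\<close> has
  \<open>length w - (p + length u)\<close> letters, so it is empty exactly when
  \<open>p + length u = length w\<close>.\<close>

lemma suffix_words_iff:
  "w \<in> suffix_words u \<longleftrightarrow>
    w \<in> words \<and> (\<exists>p. occurs_at u w p) \<and> (\<forall>p. occurs_at u w p \<longrightarrow> p + length u = length w)"
proof -
  have "factor_le u w \<longleftrightarrow> (\<exists>p. occurs_at u w p)"
    unfolding factor_le_def using embedding_occurs_at(1) occurs_at_embedding by blast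
  moreover have "(\<forall>p w' s. embedding u w p w' s \<longrightarrow> s = [])
      \<longleftrightarrow> (\<forall>p. occurs_at u w p \<longrightarrow> p + length u = length w)" (is "?L \<longleftrightarrow> ?R")
  proof
    assume ?L
    show ?R
    proof (intro allI impI)
      fix p assume p: "occurs_at u w p"
      have "drop (p + length u) w = []"
        using \<open>?L\<close> occurs_at_embedding[OF p] by blast
      thus "p + length u = length w" using p by (simp add: occurs_at_def)
    qed
  next
    assume ?R
    thus ?L by (metis add_cancel_right_right embedding_occurs_at length_0_conv)
  qed
  ultimately show ?thesis by (simp add: suffix_words_def)
qed

lemma suffix_words_subset: "suffix_words u \<subseteq> words"
  by (auto simp: suffix_words_def)

lemma append_words_iff: "u @ v \<in> words \<longleftrightarrow> u \<in> words \<and> v \<in> words"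
  by (auto simp: words_def)

section \<open>Patterns that begin with ones\<close>

lemma words_over_positive: "words_over {1..} n = {w \<in> words. length w = n}"
  by (auto simp: words_over_def words_def Suc_le_eq)

text \<open>The ones put no constraint on positive letters. The copy of \<open>u\<close> starts
  \<open>k\<close> letters into the occurrence, at position \<open>p + k\<close> of
  \<open>v @ w\<close>, which is position \<open>p\<close> of \<open>w\<close>.\<close>

lemma occurs_at_ones_append:
  assumes "v @ w \<in> words" "length v = k"
  shows "occurs_at (replicate k 1 @ u) (v @ w) p \<longleftrightarrow> occurs_at u w p"
proof
  assume L: "occurs_at (replicate k 1 @ u) (v @ w) p"
  show "occurs_at u w p"
    unfolding occurs_at_def
  proof (intro conjI allI impI)
    show "p + length u \<le> length w" using L assms by (simp add: occurs_at_def)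
    fix i assume "i < length u"
    hence "(replicate k 1 @ u) ! (k + i) \<le> (v @ w) ! (p + (k + i))"
      using L by (simp add: occurs_at_def)
    thus "u ! i \<le> w ! (p + i)"
      using assms by (simp add: nth_append)
  qed
next
  assume R: "occurs_at u w p"
  have pos: "(v @ w) ! j \<ge> 1" if "j < length (v @ w)" for j
    using assms that nth_mem[OF that] by (auto simp: words_def lists_eq_set Suc_le_eq)
  show "occurs_at (replicate k 1 @ u) (v @ w) p"
    unfolding occurs_at_def
  proof (intro conjI allI impI)
    show le: "p + length (replicate k 1 @ u) \<le> length (v @ w)"
      using R assms by (simp add: occurs_at_def)
    fix i assume i: "i < length (replicate k 1 @ u)"
    show "(replicate k 1 @ u) ! i \<le> (v @ w) ! (p + i)"
    proof (cases "i < k")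
      case True
      thus ?thesis using pos[of "p + i"] le i by (simp add: nth_append)
    next
      case False
      then obtain j where "i = k + j" using le_Suc_ex by (metis not_less)
      thus ?thesis using R i assms by (simp add: occurs_at_def nth_append)
    qed
  qed
qed

text \<open>Cutting off the first \<open>k\<close> letters preserves the positions of occurrences
  and shortens pattern and word alike, so the condition on where occurrences end is preserved
  too.\<close>

lemma suffix_words_ones_append:
  "suffix_words (replicate k 1 @ u) = concat_sets (words_over {1..} k) (suffix_words u)"
proof (intro equalityI subsetI)
  fix w assume w: "w \<in> suffix_words (replicate k 1 @ u)"
  hence "k \<le> length w" by (auto simp: suffix_words_iff occurs_at_def)
  define v r where "v = take k w" and "r = drop k w"
  have vr: "w = v @ r" "length v = k"
    using \<open>k \<le> length w\<close> by (simp_all add: v_def r_def)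
  have ws: "v @ r \<in> words" using w vr by (simp add: suffix_words_iff)
  have "r \<in> suffix_words u"
    using w ws vr(2) unfolding vr(1) suffix_words_iff occurs_at_ones_append[OF ws vr(2)]
    by (simp add: append_words_iff)
  moreover have "v \<in> words_over {1..} k"
    using ws vr(2) words_over_positive[of k] by (simp add: append_words_iff)
  ultimately show "w \<in> concat_sets (words_over {1..} k) (suffix_words u)"
    unfolding vr(1) by (intro concat_setsI)
next
  fix w assume "w \<in> concat_sets (words_over {1..} k) (suffix_words u)"
  then obtain v r where vr: "w = v @ r" "v \<in> words_over {1..} k" "r \<in> suffix_words u"
    by (rule concat_setsE)
  have len: "length v = k" using vr(2) by (rule length_words_over)
  have ws: "v @ r \<in> words"
    using vr len words_over_positive[of k] by (auto simp: append_words_iff suffix_words_iff)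
  show "w \<in> suffix_words (replicate k 1 @ u)"
    using vr(3) ws len unfolding vr(1) suffix_words_iff occurs_at_ones_append[OF ws len]
    by simp
qed

section \<open>Constant patterns: cutting a word after a letter below \<open>b\<close>\<close>

lemma occurs_at_run_append:
  assumes "length v = i" "c < b" "i < l"
  shows "occurs_at (replicate l b) ((v @ [c]) @ w) p \<longleftrightarrow>
    i < p \<and> occurs_at (replicate l b) w (p - Suc i)"
proof
  assume L: "occurs_at (replicate l b) ((v @ [c]) @ w) p"
  \<comment> \<open>An occurrence starting at \<open>p \<le> i\<close> would cover position
    \<open>i\<close>, because \<open>i < l\<close>, and would match a letter \<open>b\<close> of the
    pattern with \<open>c < b\<close>.\<close>
  have "i < p"
  proof (rule ccontr)
    assume "\<not> i < p"
    moreover have "i - p < l" using assms(3) by simp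
    ultimately have "b \<le> ((v @ [c]) @ w) ! (p + (i - p))"
      using L unfolding occurs_at_def by (metis length_replicate nth_replicate)
    thus False using \<open>\<not> i < p\<close> assms by (simp add: nth_append)
  qed
  then obtain q where "p = Suc i + q" by (metis Suc_leI le_Suc_ex)
  thus "i < p \<and> occurs_at (replicate l b) w (p - Suc i)"
    using L assms by (auto simp: occurs_at_def nth_append add.assoc)
next
  assume R: "i < p \<and> occurs_at (replicate l b) w (p - Suc i)"
  then obtain q where "p = Suc i + q" by (metis Suc_leI le_Suc_ex)
  thus "occurs_at (replicate l b) ((v @ [c]) @ w) p"
    using R assms by (auto simp: occurs_at_def nth_append add.assoc)
qed

text \<open>The occurrences in the long word are those in \<open>w\<close> shifted by
  \<open>Suc i\<close>, so existence and the end condition both transfer.\<close>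

lemma suffix_words_run_append:
  assumes "length v = i" "c < b" "i < l" "(v @ [c]) @ w \<in> words"
  shows "(v @ [c]) @ w \<in> suffix_words (replicate l b) \<longleftrightarrow> w \<in> suffix_words (replicate l b)"
    (is "?L \<longleftrightarrow> ?R")
proof -
  note occ = occurs_at_run_append[OF assms(1-3), of w]
  have w: "w \<in> words" using assms(4) by (simp only: append_words_iff)
  \<comment> \<open>The substitution \<open>p = Suc i + q\<close>, stated for arbitrary
    \<open>Q\<close> so that it can rewrite the unfolded membership condition.\<close>
  have ex: "(\<exists>p. i < p \<and> Q (p - Suc i)) \<longleftrightarrow> (\<exists>q. Q q)" for Q
    by (metis add_diff_cancel_left' less_add_Suc1 add_Suc)
  have all: "(\<forall>p. i < p \<and> Q (p - Suc i) \<longrightarrow> p + l = Suc i + n)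
      \<longleftrightarrow> (\<forall>q. Q q \<longrightarrow> q + l = n)" for Q n
  proof
    assume A: "\<forall>p. i < p \<and> Q (p - Suc i) \<longrightarrow> p + l = Suc i + n"
    show "\<forall>q. Q q \<longrightarrow> q + l = n"
    proof (intro allI impI)
      fix q assume "Q q"
      thus "q + l = n" using A[rule_format, of "Suc i + q"] by simp
    qed
  next
    assume "\<forall>q. Q q \<longrightarrow> q + l = n"
    thus "\<forall>p. i < p \<and> Q (p - Suc i) \<longrightarrow> p + l = Suc i + n" by fastforce
  qed
  have len: "length ((v @ [c]) @ w) = Suc i + length w" using assms(1) by simp
  show ?thesis
    unfolding suffix_words_iff occ len length_replicate ex all using w assms(4) by simp
qed

lemma suffix_words_run:
  assumes "b \<ge> 1" "l \<ge> 1"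
  shows "suffix_words (replicate l b) = words_over {b..} l \<union>
    (\<Union>i<l. concat_sets (concat_sets (words_over {b..} i) (words_over {1..<b} 1))
      (suffix_words (replicate l b)))" (is "?S = ?A \<union> (\<Union>i<l. ?C i)")
proof (intro equalityI subsetI)
  fix w assume w: "w \<in> ?S"
  define v r where "v = takeWhile (\<lambda>a. b \<le> a) w" and "r = dropWhile (\<lambda>a. b \<le> a) w"
  have wvr: "w = v @ r" by (simp add: v_def r_def)
  have v: "a \<in> set v \<Longrightarrow> b \<le> a" for a unfolding v_def by (auto dest: set_takeWhileD)
  show "w \<in> ?A \<union> (\<Union>i<l. ?C i)"
  proof (cases "length v < l")
    case False
    \<comment> \<open>A run of at least \<open>l\<close> large letters gives an occurrence at
      position 0, which must end the word and so forces length \<open>l\<close>.\<close>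
    hence "occurs_at (replicate l b) w 0"
      using v nth_mem[of _ v] by (auto simp: occurs_at_def wvr nth_append)
    hence "length w = l" using w by (auto simp: suffix_words_iff)
    hence "w \<in> ?A" using False wvr v by (auto simp: words_over_def)
    thus ?thesis ..
  next
    case True
    \<comment> \<open>The word has at least \<open>l\<close> letters but \<open>v\<close> has fewer,
      so some letter \<open>c < b\<close> follows the initial run.\<close>
    have "\<exists>p. occurs_at (replicate l b) w p" using w by (simp add: suffix_words_iff)
    hence "l \<le> length w" by (auto simp: occurs_at_def)
    hence "r \<noteq> []" using True wvr by auto
    then obtain c s where r: "r = c # s" by (cases r) auto
    have "c < b" using r hd_dropWhile[of "\<lambda>a. b \<le> a" w] by (auto simp: r_def)
    have wcs: "w = (v @ [c]) @ s" using wvr r by simp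
    have ws: "w \<in> words" using w by (simp add: suffix_words_iff)
    have "s \<in> ?S"
      using w suffix_words_run_append[OF refl \<open>c < b\<close> True] ws unfolding wcs by blast
    moreover have "v \<in> words_over {b..} (length v)" using v by (auto simp: words_over_def)
    moreover have "[c] \<in> words_over {1..<b} 1"
      using ws \<open>c < b\<close> unfolding wcs by (auto simp: words_over_def words_def)
    ultimately have "w \<in> ?C (length v)" unfolding wcs by (intro concat_setsI)
    thus ?thesis using True by blast
  qed
next
  fix w assume "w \<in> ?A \<union> (\<Union>i<l. ?C i)"
  thus "w \<in> ?S"
  proof
    assume w: "w \<in> ?A"
    hence "w \<in> words" using assms words_over_words[of "{b..}" l] by auto
    moreover have "occurs_at (replicate l b) w p \<longleftrightarrow> p = 0" for p
      using w by (auto simp: occurs_at_def words_over_def dest: nth_mem)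
    ultimately show ?thesis using w by (simp add: suffix_words_iff words_over_def)
  next
    assume "w \<in> (\<Union>i<l. ?C i)"
    then obtain i where i: "i < l" "w \<in> ?C i" by blast
    then obtain v c s where w: "w = (v @ c) @ s" "v \<in> words_over {b..} i"
      "c \<in> words_over {1..<b} 1" "s \<in> ?S"
      by (elim concat_setsE) auto
    from w(3) obtain d where d: "c = [d]" "1 \<le> d" "d < b"
      by (auto simp: words_over_def length_Suc_conv)
    have "v \<in> words" using w(2) assms words_over_words[of "{b..}" i] by auto
    hence "(v @ [d]) @ s \<in> words"
      using d w(4) suffix_words_subset by (auto simp: append_words_iff words_def)
    thus ?thesis
      using suffix_words_run_append[OF length_words_over[OF w(2)] d(3) i(1)] w(1,4) d(1) by blast
  qed
qed

text \<open>The length of the initial run of large letters recovers \<open>i\<close> from the word,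
  which makes the pieces of the decomposition disjoint.\<close>

lemma takeWhile_run:
  assumes "w \<in> concat_sets (concat_sets (words_over {b..} i) (words_over {1..<b} 1)) Z"
  shows "length (takeWhile (\<lambda>a. b \<le> a) w) = i"
proof -
  from assms obtain v c s where w: "w = (v @ c) @ s" "v \<in> words_over {b..} i"
    "c \<in> words_over {1..<b} 1"
    by (elim concat_setsE) auto
  from w(3) obtain d where d: "c = [d]" "d < b"
    by (auto simp: words_over_def length_Suc_conv)
  have "takeWhile (\<lambda>a. b \<le> a) w = v"
    using w(2) d unfolding w(1)
    by (subst append_assoc, subst takeWhile_append2) (auto simp: words_over_def)
  thus ?thesis using w(2) by (simp add: words_over_def)
qed

text \<open>Translates \<open>suffix_words_run\<close> into series: the initial run has length
  \<open>l\<close> on the first piece and \<open>i < l\<close> on the others, and the cut after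
  \<open>i + 1\<close> letters makes each concatenation unambiguous.\<close>

lemma S_gf_run:
  assumes "b \<ge> 1" "l \<ge> 1"
  shows "S_gf (replicate l b) = letter_gf {b..} ^ l +
    (\<Sum>i<l. letter_gf {b..} ^ i * letter_gf {1..<b} * S_gf (replicate l b))"
proof -
  let ?S = "suffix_words (replicate l b)"
  let ?D = "\<lambda>i. concat_sets (words_over {b..} i) (words_over {1..<b} 1)"
  have A: "words_over {b..} i \<subseteq> words" for i using assms by (intro words_over_words) auto
  have B: "words_over {1..<b} i \<subseteq> words" for i by (intro words_over_words) auto
  have D: "?D i \<subseteq> words" for i by (intro concat_sets_words A B)
  have C: "concat_sets (?D i) ?S \<subseteq> words" for i
    by (intro concat_sets_words D suffix_words_subset)
  have lenD: "length w = Suc i" if "w \<in> ?D i" for w i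
    using that by (auto elim!: concat_setsE dest!: length_words_over)
  have gfC: "formal_sum wt (concat_sets (?D i) ?S)
      = letter_gf {b..} ^ i * letter_gf {1..<b} * S_gf (replicate l b)" for i
  proof -
    have "formal_sum wt (concat_sets (?D i) ?S) = formal_sum wt (?D i) * formal_sum wt ?S"
      by (rule formal_sum_wt_concat_sets[OF D suffix_words_subset lenD])
    also have "formal_sum wt (?D i) = letter_gf {b..} ^ i * letter_gf {1..<b}"
      using assms
      by (subst formal_sum_wt_concat_sets[OF A B length_words_over])
        (simp_all add: formal_sum_wt_words_over)
    finally show ?thesis by (simp add: S_gf_def)
  qed
  have run: "length (takeWhile (\<lambda>a. b \<le> a) w) = l" if "w \<in> words_over {b..} l" for w
    using that by (subst takeWhile_eq_all_conv[THEN iffD2]) (auto simp: words_over_def)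
  have disj: "words_over {b..} l \<inter> (\<Union>i<l. concat_sets (?D i) ?S) = {}"
  proof (rule equals0I)
    fix w assume "w \<in> words_over {b..} l \<inter> (\<Union>i<l. concat_sets (?D i) ?S)"
    then obtain i where w: "w \<in> words_over {b..} l" "i < l" "w \<in> concat_sets (?D i) ?S"
      by blast
    show False using run[OF w(1)] takeWhile_run[OF w(3)] w(2) by simp
  qed
  have "S_gf (replicate l b)
      = formal_sum wt (words_over {b..} l \<union> (\<Union>i<l. concat_sets (?D i) ?S))"
    unfolding S_gf_def by (rule arg_cong[OF suffix_words_run[OF assms]])
  also have "\<dots> = formal_sum wt (words_over {b..} l)
      + formal_sum wt (\<Union>i<l. concat_sets (?D i) ?S)"
    by (intro formal_sum_wt_Un A disj) (use C in blast)
  also have "formal_sum wt (\<Union>i<l. concat_sets (?D i) ?S)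
      = (\<Sum>i<l. formal_sum wt (concat_sets (?D i) ?S))"
  proof (rule formal_sum_wt_UN)
    show "disjoint_family_on (\<lambda>i. concat_sets (?D i) ?S) {..<l}"
      unfolding disjoint_family_on_def using takeWhile_run by blast
  qed (use C in auto)
  also have "formal_sum wt (words_over {b..} l) = letter_gf {b..} ^ l"
    using assms by (intro formal_sum_wt_words_over) simp
  finally show ?thesis unfolding gfC .
qed

lemma S_gf_ones_append: "S_gf (replicate k 1 @ u) = letter_gf {1..} ^ k * S_gf u"
  unfolding S_gf_def suffix_words_ones_append
  by (subst formal_sum_wt_concat_sets[OF words_over_words suffix_words_subset length_words_over])
    (simp_all add: formal_sum_wt_words_over)

section \<open>Solving the recurrence\<close>

text \<open>Applied with \<open>E = 1 - x\<close>, \<open>z = t * x ^ b\<close> and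
  \<open>c = t * x\<close>, to clear denominators. The factor \<open>E - z = (1 - A) * E\<close>
  telescopes both the sum of powers of \<open>A\<close> and the sum in \<open>E\<close> and
  \<open>z\<close>; it is nonzero and is cancelled at the end.\<close>

lemma run_denominator:
  fixes A B E c z :: "'a :: idom"
  assumes A: "A * E = z" and B: "B * E = c - z" and ne: "E \<noteq> z"
  shows "E ^ Suc m * (1 - B * (\<Sum>i<Suc m. A ^ i))
    = E * (z ^ m * (1 - B) + (E - c) * (\<Sum>i<m. E ^ i * z ^ (m - 1 - i)))"
proof -
  define G where "G = (\<Sum>i<Suc m. A ^ i)"
  define T where "T = (\<Sum>i<m. E ^ i * z ^ (m - 1 - i))"
  have G: "(1 - A) * G = 1 - A ^ Suc m"
    unfolding G_def by (rule one_diff_power_eq[symmetric])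
  have T: "(E - z) * T = E ^ m - z ^ m"
    unfolding T_def by (subst power_diff_sumr2) (simp add: mult.commute)
  have AE: "A ^ Suc m * E ^ Suc m = z ^ Suc m"
    unfolding power_mult_distrib[symmetric] A by (rule refl)
  have Ez: "E - z = (1 - A) * E" using A by (simp add: left_diff_distrib)
  have dist: "x * (1 - y) = x - x * y" for x y :: 'a by (simp add: right_diff_distrib)
  have "(E ^ Suc m * (1 - B * G)) * (E - z)
      = E ^ Suc m * (E - z) - E ^ Suc m * (B * G) * (E - z)"
    unfolding dist by (rule left_diff_distrib)
  also have "E ^ Suc m * (B * G) * (E - z) = (B * E) * (E ^ Suc m * ((1 - A) * G))"
    unfolding Ez by (simp only: mult_ac)
  also have "E ^ Suc m * ((1 - A) * G) = E ^ Suc m - z ^ Suc m"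
    unfolding G dist AE[symmetric] by (simp only: mult.commute)
  \<comment> \<open>With \<open>B * E = c - z\<close>, both sides expand to
    \<open>(E - c) * E ^ Suc m + (c - z) * z ^ Suc m\<close>.\<close>
  also have "E ^ Suc m * (E - z) - B * E * (E ^ Suc m - z ^ Suc m)
      = z ^ m * (E - B * E) * (E - z) + (E - c) * E * (E ^ m - z ^ m)"
    unfolding B power_Suc by algebra
  also have "\<dots> = (E * (z ^ m * (1 - B) + (E - c) * T)) * (E - z)"
    unfolding T[symmetric] by algebra
  finally show ?thesis using ne unfolding G_def T_def by simp
qed

theorem theorem6p2:
  fixes k l b :: nat
  assumes "l \<ge> 1" and "b \<ge> 2"
  shows "S_gf (replicate k 1 @ replicate l b) =
    (t_var ^ (k + l) * x_var ^ (k + b * l)) /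
    ((1 - x_var) ^ (k + 1) *
       ((t_var * x_var ^ b) ^ (l - 1) * (1 - t_var * x_var * q_int (b - 1) x_var)
         + (1 - x_var - t_var * x_var) *
           (\<Sum>i<l - 1. (1 - x_var) ^ i * (t_var * x_var ^ b) ^ (l - 2 - i))))"
    (is "?S = ?N / ?Den")
proof -
  \<comment> \<open>The exponents \<open>l - 1\<close> and \<open>l - 2 - i\<close> become
    \<open>m\<close> and \<open>m - 1 - i\<close>. The sum is empty for \<open>m = 0\<close>, and
    otherwise \<open>i < m\<close> keeps the subtraction exact.\<close>
  obtain m where l: "l = Suc m" using assms(1) by (cases l) auto
  define E where "E = 1 - x_var"
  define z where "z = t_var * x_var ^ b"
  define A where "A = letter_gf {b..}"
  define B where "B = t_var * x_var * q_int (b - 1) x_var"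
  define P where "P = letter_gf {1..}"
  define S where "S = S_gf (replicate l b)"
  have A: "A * E = z" unfolding A_def E_def z_def by (rule letter_gf_atLeast)
  have P: "P * E = t_var * x_var"
    using letter_gf_atLeast[of 1] unfolding P_def E_def by simp
  have "q_int (b - 1) x_var * E = 1 - x_var ^ (b - 1)"
    unfolding q_int_def E_def one_diff_power_eq by (rule mult.commute)
  hence "B * E = t_var * x_var * (1 - x_var ^ (b - 1))"
    unfolding B_def by (simp only: mult.assoc)
  hence B: "B * E = t_var * x_var - z"
    using assms(2) unfolding z_def by (cases b) (simp_all add: algebra_simps)
  have "E $ 0 $ 0 = 1" "z $ 0 $ 0 = 0" by (simp_all add: E_def z_def)
  hence ne: "E \<noteq> z" by auto
  have "S = A ^ l + (\<Sum>i<l. A ^ i * B * S)"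
    using S_gf_run[of b l] letter_gf_less[of b] assms unfolding A_def B_def S_def by simp
  hence S: "S * (1 - B * (\<Sum>i<l. A ^ i)) = A ^ l"
    by (simp add: algebra_simps flip: sum_distrib_left sum_distrib_right)
  define D where "D = z ^ m * (1 - B) + (E - t_var * x_var) * (\<Sum>i<m. E ^ i * z ^ (m - 1 - i))"
  have Den: "?Den = E ^ k * (E * D)"
    unfolding D_def E_def z_def B_def l by (simp add: mult.assoc)
  \<comment> \<open>Of the \<open>k + 1\<close> factors \<open>E\<close>, \<open>k\<close> clear the
    denominators of \<open>P ^ k\<close>; the last one turns \<open>D\<close> into the left side of
    \<open>run_denominator\<close>, whose \<open>E ^ l\<close> clears \<open>A ^ l\<close>.\<close>
  have "?S * ?Den = (P * E) ^ k * (S * (E * D))"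
    unfolding Den S_gf_ones_append P_def S_def by (simp add: power_mult_distrib algebra_simps)
  also have "E * D = E ^ l * (1 - B * (\<Sum>i<l. A ^ i))"
    unfolding D_def l by (rule run_denominator[OF A B ne, symmetric])
  also have "S * \<dots> = (A * E) ^ l"
    by (simp only: power_mult_distrib S[symmetric] mult_ac)
  also have "(P * E) ^ k * \<dots> = ?N"
    unfolding A P z_def by (simp add: power_mult_distrib power_add power_mult mult_ac)
  finally have eq: "?S * ?Den = ?N" .
  \<comment> \<open>The constant coefficient 1 makes the denominator invertible, so the quotient is
    genuine and can be compared after multiplying by it.\<close>
  have nz: "?Den $ 0 $ 0 \<noteq> 0" using denominator_nth_0_0[OF assms] by simp
  hence ne0: "?Den \<noteq> 0" by (metis fps_zero_nth)
  have "?S * ?Den = ?N / ?Den * ?Den"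
    unfolding fps_fps_divide_mult_cancel[OF nz] by (rule eq)
  thus ?thesis by (rule mult_right_cancel[OF ne0, THEN iffD1])
qed

end
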